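(* Let $p,n\ge 1$ be integers and let $\Sigma_1,\ldots,\Sigma_n\in\mathbb R^{p\times p}$ be symmetric positive-semidefinite matrices. For every $z\in\Omega:=\mathbb C\setminus[0,\infty)$, there are unique scalars $\tilde\Gamma_1^z,\ldots,\tilde\Gamma_n^z\in\{a-b/z:\ a,b\ge 0\}$ and a matrix $\tilde G^z\in\mathbb C^{p\times p}$ satisfying $$\tilde G^z=-\frac1z\Bigl(I_p+\frac1n\sum_{j=1}^n\tilde\Gamma_j^z\Sigma_j\Bigr)^{-1},\qquad \tilde\Gamma_i^z=-\frac1{z\bigl(1+\frac1n\operatorname{Tr}(\Sigma_i\tilde G^z)\bigr)},\quad i\in\{1,\ldots,n\}.$$ The mappings $z\mapsto\tilde\Gamma_i^z$ ($i\in\{1,\dots,n\}$) and $z\mapsto\tilde G^z$ are holomorphic on $\Omega$.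
   Context: $\operatorname{Tr}$ is the (unnormalized) trace and $I_p$ the $p\times p$ identity matrix. In $\{a-b/z: a,b\ge0\}$, the numbers $a,b$ are real. The equations are understood to include invertibility of the matrix and nonvanishing of the denominators. *)

theory Defs
  imports "HOL-Complex_Analysis.Complex_Analysis"
begin

definition pos_semidef :: "real^'p^'p \<Rightarrow> bool" where
  "pos_semidef A \<longleftrightarrow> transpose A = A \<and> (\<forall>x. 0 \<le> x \<bullet> (A *v x))"

abbreviation complex_mat :: "real^'p^'p \<Rightarrow> complex^'p^'p" where
  "complex_mat A \<equiv> map_matrix complex_of_real A"

text \<open>The library has no scalar multiplication of a matrix by a complex number
  (\<^term>\<open>(*s)\<close> acts on vectors, \<^term>\<open>(*\<^sub>R)\<close> has real scalars).\<close>

definition cscale :: "complex \<Rightarrow> complex^'p^'p \<Rightarrow> complex^'p^'p" (infixr "*\<^sub>C" 75) where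
  "c *\<^sub>C A = map_matrix (\<lambda>x. c * x) A"

definition Omega :: "complex set" where
  "Omega = UNIV - complex_of_real ` {0..}"

definition gamma_cone :: "complex \<Rightarrow> complex set" where
  "gamma_cone z = {complex_of_real a - complex_of_real b / z | a b :: real. 0 \<le> a \<and> 0 \<le> b}"

text \<open>Since \<^const>\<open>matrix_inv\<close> and division are total functions, invertibility
  of the matrix and nonvanishing of the denominators are part of the system.
  The index types \<^typ>\<open>'p\<close> and \<^typ>\<open>'n\<close> play the role of the sets
  of \<open>p\<close> and \<open>n\<close> indices.\<close>

definition resolvent_system ::
    "('n::finite \<Rightarrow> real^'p^'p) \<Rightarrow> complex \<Rightarrow> ('n \<Rightarrow> complex) \<Rightarrow> complex^'p^'p \<Rightarrow> bool" where
  "resolvent_system \<Sigma> z \<Gamma> G \<longleftrightarrow>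
     (let M = mat 1 + (1 / real CARD('n)) *\<^sub>R (\<Sum>j\<in>UNIV. \<Gamma> j *\<^sub>C complex_mat (\<Sigma> j))
      in invertible M \<and> G = (- 1 / z) *\<^sub>C matrix_inv M) \<and>
     (\<forall>i. let d = z * (1 + 1 / of_nat CARD('n) * trace (complex_mat (\<Sigma> i) ** G))
          in d \<noteq> 0 \<and> \<Gamma> i = - 1 / d)"

end

theory Submission imports Defs begin

text \<open>
  Write \<open>z = - w\<^sup>2\<close> with \<open>Re w > 0\<close> and put \<open>\<gamma>\<^sub>i = w \<Gamma>\<^sub>i\<close>, \<open>g = w G\<close>. The system takes the symmetric form
  \<open>g = (w I + (1/n) \<Sum>\<^sub>j \<gamma>\<^sub>j S\<^sub>j)\<^sup>-\<^sup>1\<close> and \<open>\<gamma>\<^sub>i = 1 / (w + Tr (S\<^sub>i g) / n)\<close>, that is, \<open>\<gamma>\<close> is a fixed point of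
  a map \<open>fixmap\<close>. In these coordinates all \<open>z \<in> \<Omega>\<close> look alike: the only positivity in sight
  is that of real parts, and the cone \<open>{a - b/z}\<close> becomes the cone spanned by \<open>w\<close> and its conjugate,
  which lies in the right half-plane.

  Everything rests on one identity. Factor \<open>S\<^sub>j = R\<^sub>j\<^sup>T R\<^sub>j\<close> with real \<open>R\<^sub>j\<close> (Cholesky elimination). If
  \<open>N\<close> is the matrix inverted by \<open>g\<close>, then \<open>g = g N\<^sup>* g\<^sup>*\<close> shows that \<open>Tr (S\<^sub>i g)\<close> is the combination of
  \<open>cnj w\<close> and the \<open>cnj \<gamma>\<^sub>j\<close> with the nonnegative coefficients \<open>\<parallel>R\<^sub>i g\<parallel>\<^sup>2\<close> and \<open>\<parallel>R\<^sub>i g R\<^sub>j\<^sup>T\<parallel>\<^sup>2 / n\<close>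
  (\<open>trace_res\<close>).

  \<^item> Existence: by the identity, \<open>fixmap\<close> preserves the cone, and its values are bounded by \<open>1 / Re w\<close>.
    A bounded piece of the cone is compact and convex, and Brouwer's theorem applies.

  \<^item> Uniqueness: the difference \<open>\<Delta>\<close> of two solutions satisfies \<open>\<Delta> = A \<Delta>\<close> with
    \<open>A\<^sub>i\<^sub>j = \<gamma>\<^sub>i \<gamma>\<^sub>i' Tr (S\<^sub>i g S\<^sub>j g') / n\<^sup>2\<close>. By Cauchy--Schwarz for the Frobenius norm,
    \<open>|A\<^sub>i\<^sub>j|\<^sup>2 \<le> B\<^sub>i\<^sub>j B\<^sub>i\<^sub>j'\<close> with \<open>B\<^sub>i\<^sub>j = |\<gamma>\<^sub>i|\<^sup>2 \<parallel>R\<^sub>i g R\<^sub>j\<^sup>T\<parallel>\<^sup>2 / n\<^sup>2\<close>. Taking real parts in the equation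
    for \<open>\<gamma>\<close> and using the identity gives \<open>B (Re \<gamma>) < Re \<gamma>\<close> entrywise, and likewise for the other
    solution. Hence \<open>A\<close> strictly shrinks the maximum norm weighted by \<open>\<surd>(Re \<gamma>\<^sub>i Re \<gamma>\<^sub>i')\<close>, and \<open>\<Delta> = 0\<close>.

  \<^item> Holomorphy: the argument for \<open>A\<close> also applies to solutions at two different parameters, so
    \<open>I - A\<close> is always invertible. The divided difference of the solution in \<open>w\<close> solves a linear system
    with matrix \<open>I - A\<close>. The solution is continuous because it is locally bounded and has a closed
    graph; so the coefficients converge, and by Cramer's rule so does the divided difference. Finally
    \<open>w\<close> is the principal square root of \<open>- z\<close>, holomorphic on \<open>\<Omega>\<close>.
\<close>

(* The dollar sign is to denote components of vectors only, not coefficients of power series. *)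
no_notation fps_nth (infixl "$" 75)

section \<open>Factorization of positive-semidefinite matrices\<close>

lemma pos_semidef_sym:
  assumes "pos_semidef A"
  shows "A $ k $ l = A $ l $ k"
proof -
  have "transpose A $ k $ l = A $ k $ l"
    using assms by (simp add: pos_semidef_def)
  then show ?thesis by (simp add: transpose_def)
qed

text \<open>Otherwise the form would be negative at \<open>t e\<^sub>i + e\<^sub>b\<close> for a suitable \<open>t\<close>.\<close>

lemma pos_semidef_zero_row:
  fixes A :: "real^'p^'p"
  assumes A: "pos_semidef A" and c: "A $ i $ i = 0"
  shows "A $ i $ b = 0"
proof (rule ccontr)
  assume nz: "A $ i $ b \<noteq> 0"
  note sym = pos_semidef_sym[OF A]
  \<comment> \<open>This \<open>t\<close> makes the form, which is affine in \<open>t\<close>, take the value \<open>-1\<close>.\<close>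
  define t where "t = - (A $ b $ b + 1) / (2 * A $ i $ b)"
  let ?x = "t *\<^sub>R axis i 1 + axis b 1 :: real^'p"
  have e: "axis k 1 \<bullet> (A *v axis l 1) = A $ k $ l" for k l
    by (simp add: inner_axis' matrix_vector_mult_basis column_def)
  have "?x \<bullet> (A *v ?x) = t * t * A $ i $ i + 2 * t * A $ i $ b + A $ b $ b"
    by (simp add: matrix_vector_right_distrib matrix_vector_mult_scaleR inner_add_left
        inner_add_right e sym[of b i] algebra_simps)
  also have "\<dots> = -1"
    using nz c by (simp add: t_def field_simps)
  finally show False
    using A unfolding pos_semidef_def by (metis not_one_le_zero neg_0_le_iff_le)
qed

text \<open>Subtracting the rank-one matrix with vector \<open>A e\<^sub>i / \<surd>A\<^sub>i\<^sub>i\<close> from \<open>A\<close> clears row and column \<open>i\<close>.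
  The remaining form is the minimum of the form of \<open>A\<close> over translations along \<open>e\<^sub>i\<close>, hence still
  nonnegative. For \<open>A\<^sub>i\<^sub>i = 0\<close> division by zero makes \<open>u = 0\<close> and \<open>A' = A\<close>, whose row \<open>i\<close> vanishes
  already.\<close>

lemma pos_semidef_eliminate:
  fixes A :: "real^'p^'p" and i :: 'p
  assumes A: "pos_semidef A"
  defines "u \<equiv> (1 / sqrt (A $ i $ i)) *\<^sub>R (A $ i)"
  defines "A' \<equiv> (\<chi> a b. A $ a $ b - u $ a * u $ b)"
  shows "pos_semidef A'" and "A' $ i $ b = 0" and "A' $ b $ i = 0"
proof -
  let ?c = "A $ i $ i"
  note sym = pos_semidef_sym[OF A]
  have e: "axis k 1 \<bullet> (A *v axis l 1) = A $ k $ l" for k l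
    by (simp add: inner_axis' matrix_vector_mult_basis column_def)
  have c: "0 \<le> ?c"
    using A e[of i i] unfolding pos_semidef_def by metis
  have uu: "u $ a * u $ b = A $ i $ a * A $ i $ b / ?c" for a b
    using c by (simp add: u_def field_simps flip: power2_eq_square)
  show row: "A' $ i $ b = 0" for b
    using pos_semidef_zero_row[OF A] by (cases "?c = 0") (auto simp: A'_def uu)
  show "A' $ b $ i = 0"
    using row[of b] by (simp add: A'_def sym[of b i] mult.commute)
  have "0 \<le> x \<bullet> (A' *v x)" for x
  proof -
    define t where "t = (A $ i \<bullet> x) / ?c"
    have Ae: "A *v axis i 1 = A $ i"
      by (simp add: matrix_vector_mult_basis column_def vec_eq_iff sym[of i])
    let ?y = "x - t *\<^sub>R axis i 1"
    have "?y \<bullet> (A *v ?y) = x \<bullet> (A *v x) - 2 * t * (A $ i \<bullet> x) + t * t * ?c"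
      by (simp add: matrix_vector_mult_diff_distrib matrix_vector_mult_scaleR inner_diff_left
          inner_diff_right matrix_vector_mul_component Ae inner_axis' inner_commute[of x] algebra_simps)
    also have "\<dots> = x \<bullet> (A *v x) - (A $ i \<bullet> x)\<^sup>2 / ?c"
      by (cases "?c = 0") (simp_all add: t_def field_simps power2_eq_square)
    also have "\<dots> = x \<bullet> (A' *v x)"
    proof -
      have "A' *v x = A *v x - ((A $ i \<bullet> x) / ?c) *\<^sub>R A $ i"
        by (simp add: vec_eq_iff A'_def uu matrix_vector_mult_def inner_vec_def
            sum_subtractf sum_distrib_left sum_distrib_right sum_divide_distrib algebra_simps)
      then show ?thesis
        by (simp add: inner_diff_right inner_commute[of x "A $ i"] power2_eq_square)
    qed
    finally show ?thesis
      using A unfolding pos_semidef_def by metis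
  qed
  then show "pos_semidef A'"
    by (simp add: pos_semidef_def vec_eq_iff transpose_def A'_def sym mult.commute)
qed

text \<open>The rows of \<open>R\<close> are the vectors eliminated successively; the induction is on the set of
  indices that have not been cleared.\<close>

theorem pos_semidef_factorization:
  fixes A :: "real^'p^'p"
  assumes "pos_semidef A"
  obtains R :: "real^'p^'p" where "A = transpose R ** R"
proof -
  have "\<exists>R :: real^'p^'p. \<forall>a b. A $ a $ b = (\<Sum>k\<in>S. R $ k $ a * R $ k $ b)"
    if "finite S" "pos_semidef A" "\<And>a b. a \<notin> S \<or> b \<notin> S \<Longrightarrow> A $ a $ b = 0"
    for S :: "'p set" and A
    using that
  proof (induction S arbitrary: A rule: finite_induct)
    case empty
    then show ?case by auto
  next
    case (insert i S)
    define u where "u = (1 / sqrt (A $ i $ i)) *\<^sub>R (A $ i)"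
    define A' :: "real^'p^'p" where "A' = (\<chi> a b. A $ a $ b - u $ a * u $ b)"
    note el = pos_semidef_eliminate[OF insert.prems(1), of i, folded u_def, folded A'_def]
    have "u $ a = 0" if "a \<notin> insert i S" for a
      using insert.prems(2)[of i a] that by (simp add: u_def)
    then have "A' $ a $ b = 0" if "a \<notin> S \<or> b \<notin> S" for a b
      using that el(2,3) insert.prems(2)[of a b]
      by (cases "a = i \<or> b = i") (auto simp: A'_def)
    from insert.IH[OF el(1) this] obtain R :: "real^'p^'p"
      where R: "\<And>a b. A' $ a $ b = (\<Sum>k\<in>S. R $ k $ a * R $ k $ b)" by blast
    have "A $ a $ b = (\<Sum>k\<in>insert i S. (\<chi> k. if k = i then u else R $ k) $ k $ a
          * (\<chi> k. if k = i then u else R $ k) $ k $ b)" for a b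
    proof -
      have "A $ a $ b = u $ a * u $ b + A' $ a $ b"
        by (simp add: A'_def)
      also have "A' $ a $ b = (\<Sum>k\<in>S. (\<chi> k. if k = i then u else R $ k) $ k $ a
          * (\<chi> k. if k = i then u else R $ k) $ k $ b)"
        unfolding R using insert.hyps by (intro sum.cong) auto
      finally show ?thesis
        using insert.hyps by simp
    qed
    then show ?case by blast
  qed
  from this[of UNIV A] assms obtain R :: "real^'p^'p"
    where "\<And>a b. A $ a $ b = (\<Sum>k\<in>UNIV. R $ k $ a * R $ k $ b)" by auto
  then have "A = transpose R ** R"
    by (simp add: vec_eq_iff matrix_matrix_mult_def transpose_def)
  then show thesis by (rule that)
qed

section \<open>Complex matrices: scaling, conjugation, traces, inverses\<close>

lemma nth_cscale [simp]: "(c *\<^sub>C A) $ i $ j = c * A $ i $ j"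
  by (simp add: cscale_def)

lemma cscale_mult_left: "(c *\<^sub>C A) ** B = c *\<^sub>C (A ** B)"
  by (simp add: vec_eq_iff matrix_matrix_mult_def sum_distrib_left mult.assoc)

lemma cscale_mult_right: "A ** (c *\<^sub>C B) = c *\<^sub>C (A ** B)"
  by (simp add: vec_eq_iff matrix_matrix_mult_def sum_distrib_left mult_ac)

lemma cscale_cscale: "a *\<^sub>C b *\<^sub>C A = (a * b) *\<^sub>C A"
  by (simp add: vec_eq_iff)

lemma cscale_mult_vec: "(c *\<^sub>C A) *v x = c *s (A *v x)"
  by (simp add: vec_eq_iff matrix_vector_mult_def sum_distrib_left mult.assoc)

lemma trace_cscale: "trace (c *\<^sub>C A) = c * trace A"
  by (simp add: trace_def sum_distrib_left)

lemma transpose_cscale: "transpose (c *\<^sub>C A) = c *\<^sub>C transpose A"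
  by (simp add: vec_eq_iff transpose_def)

lemma mat_eq_cscale: "mat c = c *\<^sub>C mat 1"
  by (simp add: vec_eq_iff mat_def)

lemma matrix_add_rdistrib: "(A + B) ** C = A ** C + B ** (C :: complex^'p^'p)"
  by (simp add: vec_eq_iff matrix_matrix_mult_def distrib_right sum.distrib)

lemma matrix_mult_sum_left: "(\<Sum>j\<in>S. f j) ** B = (\<Sum>j\<in>S. f j ** (B :: complex^'p^'p))"
  by (induction S rule: infinite_finite_induct) (auto simp: matrix_add_rdistrib)

lemma matrix_mult_sum_right: "B ** (\<Sum>j\<in>S. f j) = (\<Sum>j\<in>S. (B :: complex^'p^'p) ** f j)"
  by (induction S rule: infinite_finite_induct) (auto simp: matrix_add_ldistrib)

lemma matrix_sum_mult_vec: "(\<Sum>j\<in>S. f j) *v x = (\<Sum>j\<in>S. f j *v (x :: complex^'p))"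
  by (induction S rule: infinite_finite_induct) (auto simp: matrix_vector_mult_add_rdistrib)

lemma trace_sum: "trace (\<Sum>j\<in>S. f j) = (\<Sum>j\<in>S. trace (f j :: complex^'p^'p))"
  by (induction S rule: infinite_finite_induct) (auto simp: trace_add trace_0[simplified])

lemma transpose_sum: "transpose (\<Sum>j\<in>S. f j) = (\<Sum>j\<in>S. transpose (f j :: complex^'p^'p))"
  by (simp add: vec_eq_iff transpose_def)

abbreviation cnj_mat :: "complex^'p^'p \<Rightarrow> complex^'p^'p" where
  "cnj_mat \<equiv> map_matrix cnj"

lemma cnj_mat_mult: "cnj_mat (A ** B) = cnj_mat A ** cnj_mat B"
  by (simp add: vec_eq_iff matrix_matrix_mult_def)

lemma cnj_mat_add: "cnj_mat (A + B) = cnj_mat A + cnj_mat B"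
  by (simp add: vec_eq_iff)

lemma cnj_mat_sum: "cnj_mat (\<Sum>j\<in>S. f j) = (\<Sum>j\<in>S. cnj_mat (f j))"
  by (simp add: vec_eq_iff)

lemma cnj_mat_cscale: "cnj_mat (c *\<^sub>C A) = cnj c *\<^sub>C cnj_mat A"
  by (simp add: vec_eq_iff)

lemma cnj_mat_mat: "cnj_mat (mat c) = mat (cnj c)"
  by (simp add: vec_eq_iff mat_def)

lemma cnj_mat_transpose: "cnj_mat (transpose A) = transpose (cnj_mat A)"
  by (simp add: vec_eq_iff transpose_def)

lemma trace_mult_transpose:
  fixes X Y :: "complex^'p^'p"
  shows "trace (X ** transpose Y) = (\<Sum>k\<in>UNIV. \<Sum>l\<in>UNIV. X $ k $ l * Y $ k $ l)"
  by (simp add: trace_def matrix_matrix_mult_def transpose_def)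

lemma power2_norm_matrix:
  fixes X :: "complex^'p^'p"
  shows "(norm X)\<^sup>2 = (\<Sum>k\<in>UNIV. \<Sum>l\<in>UNIV. (norm (X $ k $ l))\<^sup>2)"
  by (simp add: norm_vec_def L2_set_def sum_nonneg)

lemma trace_mult_cnj_transpose:
  fixes X :: "complex^'p^'p"
  shows "trace (X ** transpose (cnj_mat X)) = of_real ((norm X)\<^sup>2)"
  by (simp add: trace_mult_transpose power2_norm_matrix complex_norm_square del: of_real_power)

lemma norm_trace_mult_transpose_le:
  fixes X Y :: "complex^'p^'p"
  shows "(norm (trace (X ** transpose Y)))\<^sup>2 \<le> (norm X)\<^sup>2 * (norm Y)\<^sup>2"
proof -
  have "norm (trace (X ** transpose Y))
      \<le> (\<Sum>(k,l)\<in>UNIV. norm (X $ k $ l) * norm (Y $ k $ l))"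
    unfolding trace_mult_transpose sum.cartesian_product UNIV_Times_UNIV
    by (rule sum_norm_le) (auto simp: norm_mult)
  then have "(norm (trace (X ** transpose Y)))\<^sup>2
      \<le> (\<Sum>p\<in>UNIV. norm (X $ fst p $ snd p) * norm (Y $ fst p $ snd p))\<^sup>2"
    by (intro power_mono) (auto simp: case_prod_beta)
  also have "\<dots> \<le> (\<Sum>p\<in>UNIV. (norm (X $ fst p $ snd p))\<^sup>2) * (\<Sum>p\<in>UNIV. (norm (Y $ fst p $ snd p))\<^sup>2)"
    by (rule Cauchy_Schwarz_ineq_sum)
  also have "\<dots> = (norm X)\<^sup>2 * (norm Y)\<^sup>2"
    unfolding power2_norm_matrix sum.cartesian_product UNIV_Times_UNIV
    by (simp add: case_prod_beta)
  finally show ?thesis .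
qed

text \<open>Regrouping a product of four factors around the factorizations \<open>P\<^sup>T P\<close> and \<open>Q\<^sup>T Q\<close>. With
  \<open>trace_mult_cnj_transpose\<close> it turns traces of resolvents into squared norms.\<close>

lemma trace_factorized:
  fixes g :: "complex^'p^'p"
  assumes "transpose g' = g'"
  shows "trace ((transpose P ** P) ** g ** (transpose Q ** Q) ** g')
    = trace ((P ** g ** transpose Q) ** transpose (P ** g' ** transpose Q))"
proof -
  have "trace ((transpose P ** P) ** g ** (transpose Q ** Q) ** g')
      = trace (transpose P ** (P ** g ** transpose Q ** Q ** g'))"
    by (simp add: matrix_mul_assoc)
  also have "\<dots> = trace ((P ** g ** transpose Q ** Q ** g') ** transpose P)"
    by (rule trace_mul_sym)
  finally show ?thesis
    by (simp add: matrix_transpose_mul matrix_mul_assoc assms)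
qed

lemma matrix_inv_left:
  fixes A :: "complex^'p^'p" assumes "invertible A" shows "matrix_inv A ** A = mat 1"
  using assms unfolding invertible_def matrix_inv_def by (metis (mono_tags, lifting) someI_ex)

lemma matrix_inv_right:
  fixes A :: "complex^'p^'p" assumes "invertible A" shows "A ** matrix_inv A = mat 1"
  using assms unfolding invertible_def matrix_inv_def by (metis (mono_tags, lifting) someI_ex)

lemma matrix_inv_unique:
  fixes A B :: "complex^'p^'p" assumes "A ** B = mat 1" shows "matrix_inv A = B"
  using assms
  by (metis invertible_right_inverse matrix_inv_left matrix_mul_assoc matrix_mul_lid matrix_mul_rid)

lemma transpose_matrix_inv:
  fixes A :: "complex^'p^'p"
  assumes "invertible A" "transpose A = A"
  shows "transpose (matrix_inv A) = matrix_inv A"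
  using assms
  by (metis matrix_inv_left matrix_inv_unique matrix_transpose_mul transpose_mat)

text \<open>Cramer's rule. It exhibits the entries of the inverse as rational functions of the entries of
  the matrix, which yields continuity and holomorphy of inversion.\<close>

lemma matrix_inv_nth:
  fixes A :: "complex^'p^'p"
  assumes "invertible A"
  shows "matrix_inv A $ k $ l
    = det (\<chi> i j. if j = k then axis l 1 $ i else A $ i $ j) / det A"
proof -
  have "A *v column l (matrix_inv A) = axis l 1"
  proof -
    have "(A *v column l (matrix_inv A)) $ i = (A ** matrix_inv A) $ i $ l" for i
      by (simp add: matrix_vector_mult_def matrix_matrix_mult_def column_def)
    then show ?thesis
      by (simp add: vec_eq_iff matrix_inv_right[OF assms] mat_def axis_def)
  qed
  then have "column l (matrix_inv A) $ k
      = det (\<chi> i j. if j = k then axis l 1 $ i else A $ i $ j) / det A"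
    using cramer[of A] assms by (simp add: invertible_det_nz)
  then show ?thesis by (simp add: column_def)
qed

lemma tendsto_det:
  fixes A :: "'a \<Rightarrow> complex^'p^'p"
  assumes "\<And>i j. ((\<lambda>x. A x $ i $ j) \<longlongrightarrow> B $ i $ j) F"
  shows "((\<lambda>x. det (A x)) \<longlongrightarrow> det B) F"
  unfolding det_def by (intro tendsto_intros assms)

lemma holomorphic_on_det:
  assumes "\<And>i j. (\<lambda>x. A x $ i $ j) holomorphic_on S"
  shows "(\<lambda>x. det (A x :: complex^'p^'p)) holomorphic_on S"
  unfolding det_def by (intro holomorphic_intros assms)

lemma continuous_on_matrix_inv_nth:
  fixes A :: "'a::topological_space \<Rightarrow> complex^'p^'p"
  assumes A: "\<And>i j. continuous_on S (\<lambda>x. A x $ i $ j)" and inv: "\<And>x. x \<in> S \<Longrightarrow> invertible (A x)"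
  shows "continuous_on S (\<lambda>x. matrix_inv (A x) $ k $ l)"
proof -
  have "continuous_on S (\<lambda>x. det (\<chi> i j. if j = k then axis l 1 $ i else A x $ i $ j) / det (A x))"
    unfolding continuous_on_def
  proof (intro ballI tendsto_divide tendsto_det)
    fix x i j assume "x \<in> S"
    then have *: "((\<lambda>x. A x $ i $ j) \<longlongrightarrow> A x $ i $ j) (at x within S)" for i j
      using A by (auto simp: continuous_on_def)
    show "((\<lambda>x. A x $ i $ j) \<longlongrightarrow> A x $ i $ j) (at x within S)" by (rule *)
    show "((\<lambda>x. (\<chi> i j. if j = k then axis l 1 $ i else A x $ i $ j) $ i $ j) \<longlongrightarrow>
       (\<chi> i j. if j = k then axis l 1 $ i else A x $ i $ j) $ i $ j) (at x within S)"
      using * by (cases "j = k") auto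
  qed (use inv in \<open>auto simp: invertible_det_nz\<close>)
  then show ?thesis
    by (rule continuous_on_eq) (simp add: inv matrix_inv_nth)
qed

lemma holomorphic_on_matrix_inv_nth:
  fixes A :: "complex \<Rightarrow> complex^'p^'p"
  assumes A: "\<And>i j. (\<lambda>x. A x $ i $ j) holomorphic_on S" and inv: "\<And>x. x \<in> S \<Longrightarrow> invertible (A x)"
  shows "(\<lambda>x. matrix_inv (A x) $ k $ l) holomorphic_on S"
proof -
  have "(\<lambda>x. det (\<chi> i j. if j = k then axis l 1 $ i else A x $ i $ j) / det (A x)) holomorphic_on S"
  proof (intro holomorphic_intros holomorphic_on_det A)
    show "(\<lambda>x. (\<chi> i j. if j = k then axis l 1 $ i else A x $ i $ j) $ i $ j) holomorphic_on S" for i j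
      using A by (cases "j = k") (auto intro: holomorphic_intros)
  qed (use inv in \<open>auto simp: invertible_det_nz\<close>)
  then show ?thesis
    by (rule holomorphic_transform) (simp add: inv matrix_inv_nth)
qed

section \<open>A weighted contraction criterion\<close>

text \<open>A matrix dominated by the entrywise geometric mean of two nonnegative matrices that each
  strictly shrink some positive vector has no nonzero fixed vector: by Cauchy--Schwarz it strictly
  shrinks the maximum norm weighted by the geometric mean of the two vectors.\<close>

lemma geometric_mean_contraction:
  fixes A :: "'n::finite \<Rightarrow> 'n \<Rightarrow> complex" and B B' :: "'n \<Rightarrow> 'n \<Rightarrow> real" and \<Delta> :: "'n \<Rightarrow> complex"
  assumes A: "\<And>i j. (norm (A i j))\<^sup>2 \<le> B i j * B' i j"
    and B: "\<And>i j. 0 \<le> B i j" "\<And>i j. 0 \<le> B' i j"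
    and v: "\<And>i. 0 < v i" "\<And>i. 0 < v' i"
    and Bv: "\<And>i. (\<Sum>j\<in>UNIV. B i j * v j) < v i" "\<And>i. (\<Sum>j\<in>UNIV. B' i j * v' j) < v' i"
    and \<Delta>: "\<And>i. \<Delta> i = (\<Sum>j\<in>UNIV. A i j * \<Delta> j)"
  shows "\<Delta> i = 0"
proof -
  define \<omega> where "\<omega> = (\<lambda>i. sqrt (v i * v' i))"
  have \<omega>: "0 < \<omega> i" for i
    using v by (simp add: \<omega>_def)
  define m where "m = Max (range (\<lambda>i. norm (\<Delta> i) / \<omega> i))"
  have m: "norm (\<Delta> j) \<le> m * \<omega> j" for j
  proof -
    have "norm (\<Delta> j) / \<omega> j \<le> m" unfolding m_def by (rule Max_ge) auto
    then show ?thesis using \<omega>[of j] by (simp add: field_simps)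
  qed
  have "m \<in> range (\<lambda>i. norm (\<Delta> i) / \<omega> i)"
    unfolding m_def by (rule Max_in) auto
  then obtain k where k: "norm (\<Delta> k) = m * \<omega> k"
    using \<omega> by (auto simp: field_simps less_imp_neq[THEN not_sym])
  have entry: "norm (A k j) * \<omega> j \<le> sqrt (B k j * v j) * sqrt (B' k j * v' j)" for j
  proof -
    have "norm (A k j) \<le> sqrt (B k j * B' k j)"
      using A[of k j] by (rule real_le_rsqrt)
    then have "norm (A k j) * \<omega> j \<le> sqrt (B k j * B' k j) * \<omega> j"
      using \<omega>[of j] by (intro mult_right_mono) auto
    then show ?thesis
      by (simp add: \<omega>_def real_sqrt_mult mult_ac)
  qed
  have sq: "(\<Sum>j\<in>UNIV. sqrt (B k j * v j) * sqrt (B' k j * v' j))\<^sup>2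
      \<le> (\<Sum>j\<in>UNIV. B k j * v j) * (\<Sum>j\<in>UNIV. B' k j * v' j)"
  proof -
    have "(\<Sum>j\<in>UNIV. (sqrt (B k j * v j))\<^sup>2) = (\<Sum>j\<in>UNIV. B k j * v j)"
      "(\<Sum>j\<in>UNIV. (sqrt (B' k j * v' j))\<^sup>2) = (\<Sum>j\<in>UNIV. B' k j * v' j)"
      using B v by (simp_all add: less_imp_le)
    then show ?thesis
      using Cauchy_Schwarz_ineq_sum[of "\<lambda>j. sqrt (B k j * v j)" "\<lambda>j. sqrt (B' k j * v' j)" UNIV] by simp
  qed
  have lt: "(\<Sum>j\<in>UNIV. B k j * v j) * (\<Sum>j\<in>UNIV. B' k j * v' j) < v k * v' k"
    using Bv[of k] B v by (intro mult_strict_mono) (auto intro!: sum_nonneg simp: less_imp_le)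
  have shrink: "(\<Sum>j\<in>UNIV. norm (A k j) * \<omega> j) < \<omega> k"
  proof -
    have "(\<Sum>j\<in>UNIV. norm (A k j) * \<omega> j) \<le> (\<Sum>j\<in>UNIV. sqrt (B k j * v j) * sqrt (B' k j * v' j))"
      by (intro sum_mono entry)
    also have "\<dots> < \<omega> k"
      unfolding \<omega>_def using sq lt by (intro real_less_rsqrt) linarith
    finally show ?thesis .
  qed
  have "m * \<omega> k \<le> (\<Sum>j\<in>UNIV. norm (A k j) * norm (\<Delta> j))"
    unfolding k[symmetric] by (subst \<Delta>) (auto intro!: sum_norm_le simp: norm_mult)
  also have "\<dots> \<le> (\<Sum>j\<in>UNIV. norm (A k j) * (m * \<omega> j))"
    by (intro sum_mono mult_left_mono m) auto
  also have "\<dots> = m * (\<Sum>j\<in>UNIV. norm (A k j) * \<omega> j)"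
    by (simp add: sum_distrib_left mult_ac)
  finally have "m * (\<omega> k - (\<Sum>j\<in>UNIV. norm (A k j) * \<omega> j)) \<le> 0"
    by (simp add: algebra_simps)
  with shrink have "m \<le> 0"
    by (simp add: mult_le_0_iff)
  with m[of i] \<omega>[of i] have "norm (\<Delta> i) \<le> 0"
    by (smt (verit) mult_nonpos_nonneg)
  then show ?thesis by simp
qed

section \<open>The cone spanned by a number and its conjugate\<close>

text \<open>The image of \<^const>\<open>gamma_cone\<close> at \<open>- w\<^sup>2\<close> under multiplication by \<open>w\<close>, for \<open>w \<noteq> 0\<close>: then
  \<open>1 / w\<close> is a positive multiple of \<open>cnj w\<close>.\<close>

definition conj_cone :: "complex \<Rightarrow> complex set" where
  "conj_cone w = {of_real a * w + of_real b * cnj w | a b :: real. 0 \<le> a \<and> 0 \<le> b}"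

lemma cone_add: "x \<in> conj_cone w \<Longrightarrow> y \<in> conj_cone w \<Longrightarrow> x + y \<in> conj_cone w"
  unfolding conj_cone_def
proof clarify
  fix a b a' b' :: real
  assume "0 \<le> a" "0 \<le> b" "0 \<le> a'" "0 \<le> b'"
  then show "\<exists>a'' b''. of_real a * w + of_real b * cnj w + (of_real a' * w + of_real b' * cnj w) =
      of_real a'' * w + of_real b'' * cnj w \<and> 0 \<le> a'' \<and> 0 \<le> b''"
    by (intro exI[of _ "a + a'"] exI[of _ "b + b'"]) (auto simp: algebra_simps)
qed

lemma cone_scale: "x \<in> conj_cone w \<Longrightarrow> 0 \<le> c \<Longrightarrow> x * of_real c \<in> conj_cone w"
  unfolding conj_cone_def
proof clarify
  fix a b :: real
  assume "0 \<le> a" "0 \<le> b" "0 \<le> c"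
  then show "\<exists>a' b'. (of_real a * w + of_real b * cnj w) * of_real c =
      of_real a' * w + of_real b' * cnj w \<and> 0 \<le> a' \<and> 0 \<le> b'"
    by (intro exI[of _ "a * c"] exI[of _ "b * c"]) (auto simp: algebra_simps)
qed

lemma cone_cnj: "x \<in> conj_cone w \<Longrightarrow> cnj x \<in> conj_cone w"
  unfolding conj_cone_def
proof clarify
  fix a b :: real
  assume "0 \<le> a" "0 \<le> b"
  then show "\<exists>a' b'. cnj (of_real a * w + of_real b * cnj w) = of_real a' * w + of_real b' * cnj w
      \<and> 0 \<le> a' \<and> 0 \<le> b'"
    by (intro exI[of _ b] exI[of _ a]) auto
qed

lemma cone_zero: "0 \<in> conj_cone w"
  unfolding conj_cone_def by (auto intro!: exI[of _ 0])

lemma cone_generator: "w \<in> conj_cone w"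
  unfolding conj_cone_def by (intro CollectI exI[of _ 1] exI[of _ 0]) simp

lemma cone_sum: "(\<And>j. j \<in> I \<Longrightarrow> f j \<in> conj_cone w) \<Longrightarrow> (\<Sum>j\<in>I. f j) \<in> conj_cone w"
  by (induction I rule: infinite_finite_induct) (auto intro: cone_add cone_zero)

text \<open>The inverse of \<open>x\<close> is a nonnegative multiple of \<open>cnj x\<close>, and the cone is invariant under
  conjugation.\<close>

lemma cone_inverse: "x \<in> conj_cone w \<Longrightarrow> 1 / x \<in> conj_cone w"
  using cone_scale[OF cone_cnj, of x w "1 / (norm x)\<^sup>2"]
  by (cases "x = 0") (auto simp: cone_zero complex_div_cnj[of 1 x] simp del: of_real_power)

lemma cone_Re: "x \<in> conj_cone w \<Longrightarrow> 0 < Re w \<Longrightarrow> 0 \<le> Re x"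
  unfolding conj_cone_def by auto

section \<open>The symmetrized system\<close>

definition pencil :: "('n::finite \<Rightarrow> complex^'p^'p) \<Rightarrow> complex \<Rightarrow> complex^'n \<Rightarrow> complex^'p^'p" where
  "pencil S w \<gamma> = mat w + (\<Sum>j\<in>UNIV. (\<gamma> $ j / of_nat CARD('n)) *\<^sub>C S j)"

definition denom :: "('n::finite \<Rightarrow> complex^'p^'p) \<Rightarrow> complex \<Rightarrow> complex^'n \<Rightarrow> 'n \<Rightarrow> complex" where
  "denom S w \<gamma> i = w + trace (S i ** matrix_inv (pencil S w \<gamma>)) / of_nat CARD('n)"

definition fixmap :: "('n::finite \<Rightarrow> complex^'p^'p) \<Rightarrow> complex \<Rightarrow> complex^'n \<Rightarrow> complex^'n" where
  "fixmap S w \<gamma> = (\<chi> i. 1 / denom S w \<gamma> i)"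

text \<open>A set of pairs, because the continuity of \<^const>\<open>fixmap\<close> is needed jointly in both arguments.\<close>

definition right_half :: "(complex \<times> (complex^'n)) set" where
  "right_half = {(w, \<gamma>). 0 < Re w \<and> (\<forall>i. 0 \<le> Re (\<gamma> $ i))}"

definition is_solution :: "('n::finite \<Rightarrow> complex^'p^'p) \<Rightarrow> complex \<Rightarrow> complex^'n \<Rightarrow> bool" where
  "is_solution S w \<gamma> \<longleftrightarrow> (w, \<gamma>) \<in> right_half \<and> fixmap S w \<gamma> = \<gamma>"

text \<open>For solutions \<open>\<gamma>\<close> and \<open>\<gamma>'\<close> this matrix maps \<open>\<gamma> - \<gamma>'\<close> to itself up to an error proportional to
  \<open>w - w'\<close>. When
  the two coincide it is the Jacobian of \<^const>\<open>fixmap\<close> with respect to \<open>\<gamma>\<close>.\<close>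

definition difference_matrix ::
  "('n::finite \<Rightarrow> complex^'p^'p) \<Rightarrow> complex \<Rightarrow> complex^'n \<Rightarrow> complex \<Rightarrow> complex^'n \<Rightarrow> complex^'n^'n" where
  "difference_matrix S w \<gamma> w' \<gamma>' = (\<chi> i j. \<gamma> $ i * \<gamma>' $ i / (of_nat CARD('n))\<^sup>2
     * trace (S i ** matrix_inv (pencil S w \<gamma>) ** S j ** matrix_inv (pencil S w' \<gamma>')))"

text \<open>The factors \<open>R\<^sub>j\<close> are real matrices, embedded into the complex ones: transposition of the
  complex symmetric matrices built from the \<open>S\<^sub>j\<close> is then harmless, and conjugation is the adjoint.\<close>

locale gram_family =
  fixes R S :: "'n::finite \<Rightarrow> complex^'p^'p"
  assumes S_eq: "S j = transpose (R j) ** R j"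
    and R_real: "cnj_mat (R j) = R j"
begin

abbreviation "res w \<gamma> \<equiv> matrix_inv (pencil S w \<gamma>)"

text \<open>This is \<open>Tr (S\<^sub>i g S\<^sub>j g\<^sup>*)\<close>, written as a squared Frobenius norm to show its sign.\<close>

definition energy :: "complex^'p^'p \<Rightarrow> 'n \<Rightarrow> 'n \<Rightarrow> real" where
  "energy g i j = (norm (R i ** g ** transpose (R j)))\<^sup>2"

lemma energy_nonneg: "0 \<le> energy g i j"
  by (simp add: energy_def)

lemma transpose_S: "transpose (S j) = S j"
  by (simp add: S_eq matrix_transpose_mul)

lemma cnj_S: "cnj_mat (S j) = S j"
  by (simp add: S_eq cnj_mat_mult cnj_mat_transpose R_real)

lemma transpose_pencil: "transpose (pencil S w \<gamma>) = pencil S w \<gamma>"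
proof -
  have "transpose (A + B) = transpose A + transpose B" for A B :: "complex^'p^'p"
    by (simp add: vec_eq_iff transpose_def)
  then show ?thesis
    by (simp add: pencil_def transpose_sum transpose_cscale transpose_S)
qed

lemma quadratic_form_S:
  "(\<Sum>k\<in>UNIV. cnj (x $ k) * (S j *v x) $ k) = of_real ((norm (R j *v x))\<^sup>2)"
proof -
  have real: "cnj (R j $ l $ k) = R j $ l $ k" for l k
    using R_real[of j] by (metis nth_map_matrix)
  have S_T: "(S j *v x) $ k = (\<Sum>l\<in>UNIV. R j $ l $ k * (R j *v x) $ l)" for k
  proof -
    have "(transpose (R j) *v y) $ k = (\<Sum>l\<in>UNIV. R j $ l $ k * y $ l)" for y
      unfolding matrix_vector_mult_def transpose_def by simp
    then show ?thesis
      by (simp only: S_eq flip: matrix_vector_mul_assoc)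
  qed
  have "(\<Sum>k\<in>UNIV. cnj (x $ k) * (S j *v x) $ k)
      = (\<Sum>k\<in>UNIV. cnj (x $ k) * (\<Sum>l\<in>UNIV. R j $ l $ k * (R j *v x) $ l))"
    by (simp add: S_T)
  also have "\<dots> = (\<Sum>l\<in>UNIV. \<Sum>k\<in>UNIV. cnj (R j $ l $ k * x $ k) * (R j *v x) $ l)"
    by (simp add: sum_distrib_left real mult_ac) (rule sum.swap)
  also have "\<dots> = (\<Sum>l\<in>UNIV. cnj ((R j *v x) $ l) * (R j *v x) $ l)"
    by (simp add: matrix_vector_mult_def[of "R j"] sum_distrib_right)
  also have "\<dots> = of_real (\<Sum>l\<in>UNIV. (norm ((R j *v x) $ l))\<^sup>2)"
    unfolding of_real_sum complex_norm_square by (simp add: mult.commute)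
  also have "\<dots> = of_real ((norm (R j *v x))\<^sup>2)"
    by (simp add: norm_vec_def L2_set_def sum_nonneg)
  finally show ?thesis .
qed

text \<open>The numerical range of the pencil lies in the half-plane of real part at least \<open>Re w\<close>, which
  excludes a kernel.\<close>

lemma invertible_pencil:
  assumes "(w, \<gamma>) \<in> right_half"
  shows "invertible (pencil S w \<gamma>)"
  unfolding invertible_left_inverse matrix_left_invertible_ker
proof (intro allI impI)
  fix x :: "complex^'p" assume "pencil S w \<gamma> *v x = 0"
  then have "0 = (\<Sum>k\<in>UNIV. cnj (x $ k) * (pencil S w \<gamma> *v x) $ k)"
    by simp
  also have "\<dots> = w * (\<Sum>k\<in>UNIV. cnj (x $ k) * x $ k)
      + (\<Sum>j\<in>UNIV. \<gamma> $ j / of_nat CARD('n) * (\<Sum>k\<in>UNIV. cnj (x $ k) * (S j *v x) $ k))"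
  proof -
    have "(pencil S w \<gamma> *v x) $ k
        = w * x $ k + (\<Sum>j\<in>UNIV. \<gamma> $ j / of_nat CARD('n) * (S j *v x) $ k)" for k
      by (simp add: pencil_def matrix_vector_mult_add_rdistrib matrix_sum_mult_vec mat_eq_cscale[of w]
          cscale_mult_vec)
    then have "(\<Sum>k\<in>UNIV. cnj (x $ k) * (pencil S w \<gamma> *v x) $ k)
        = w * (\<Sum>k\<in>UNIV. cnj (x $ k) * x $ k)
         + (\<Sum>k\<in>UNIV. \<Sum>j\<in>UNIV. \<gamma> $ j / of_nat CARD('n) * (cnj (x $ k) * (S j *v x) $ k))"
      by (simp add: sum_distrib_left sum.distrib distrib_left mult_ac)
    then show ?thesis
      by (subst (asm) sum.swap) (simp add: sum_distrib_left)
  qed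
  also have "\<dots> = w * of_real ((norm x)\<^sup>2)
      + (\<Sum>j\<in>UNIV. \<gamma> $ j / of_nat CARD('n) * of_real ((norm (R j *v x))\<^sup>2))"
  proof -
    have "(\<Sum>k\<in>UNIV. cnj (x $ k) * x $ k) = of_real (\<Sum>k\<in>UNIV. (norm (x $ k))\<^sup>2)"
      unfolding of_real_sum complex_norm_square by (simp add: mult.commute)
    then show ?thesis
      unfolding quadratic_form_S by (simp add: norm_vec_def[of x] L2_set_def sum_nonneg)
  qed
  finally have "0 = Re w * (norm x)\<^sup>2
      + (\<Sum>j\<in>UNIV. Re (\<gamma> $ j) / real CARD('n) * (norm (R j *v x))\<^sup>2)"
    by (simp add: complex_eq_iff)
  moreover have "0 \<le> (\<Sum>j\<in>UNIV. Re (\<gamma> $ j) / real CARD('n) * (norm (R j *v x))\<^sup>2)"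
    using assms by (intro sum_nonneg mult_nonneg_nonneg) (auto simp: right_half_def)
  ultimately have "Re w * (norm x)\<^sup>2 \<le> 0" by linarith
  then show "x = 0"
    using assms by (simp add: right_half_def mult_le_0_iff)
qed

lemma transpose_res:
  assumes "(w, \<gamma>) \<in> right_half"
  shows "transpose (res w \<gamma>) = res w \<gamma>"
  using assms by (intro transpose_matrix_inv invertible_pencil transpose_pencil)

text \<open>Write \<open>g = g (N\<^sup>* g\<^sup>*)\<close> for the inverse \<open>g\<close> of the pencil \<open>N\<close>, where the adjoints are entrywise
  conjugates because both matrices are symmetric. Then the trace becomes a combination
  of \<open>cnj w\<close> and \<open>cnj \<gamma>\<^sub>j\<close> with nonnegative coefficients. This single identity gives the sign of the
  real parts, the invariance of the cone and the contraction estimate.\<close>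

lemma trace_res:
  assumes "(w, \<gamma>) \<in> right_half"
  shows "trace (S i ** res w \<gamma>) = cnj w * of_real ((norm (R i ** res w \<gamma>))\<^sup>2)
    + (\<Sum>j\<in>UNIV. cnj (\<gamma> $ j) / of_nat CARD('n) * of_real (energy (res w \<gamma>) i j))"
proof -
  define g where "g = res w \<gamma>"
  define g' where "g' = cnj_mat g"
  have g: "transpose g = g" and g': "transpose g' = g'"
    using transpose_res[OF assms] by (simp_all add: g_def g'_def flip: cnj_mat_transpose)
  have tr: "trace (S i ** g ** (transpose Q ** Q) ** g')
      = of_real ((norm (R i ** g ** transpose Q))\<^sup>2)" if "cnj_mat Q = Q" for Q
    unfolding S_eq trace_factorized[OF g'] trace_mult_cnj_transpose[symmetric]
    by (simp add: g'_def cnj_mat_mult cnj_mat_transpose R_real that)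
  have tr_S: "trace (S i ** g ** S j ** g') = of_real (energy g i j)" for j
    using tr[of "R j"] by (simp add: S_eq[of j] R_real energy_def)
  have tr_1: "trace (S i ** g ** g') = of_real ((norm (R i ** g))\<^sup>2)"
    using tr[of "mat 1"] by (simp add: cnj_mat_mat)
  have "cnj_mat (pencil S w \<gamma>) ** g' = mat 1"
    using matrix_inv_right[OF invertible_pencil[OF assms]]
    by (metis cnj_mat_mult cnj_mat_mat complex_cnj_one g'_def g_def)
  then have "S i ** g = S i ** g ** (cnj_mat (pencil S w \<gamma>) ** g')"
    by simp
  also have "cnj_mat (pencil S w \<gamma>)
      = cnj w *\<^sub>C mat 1 + (\<Sum>j\<in>UNIV. (cnj (\<gamma> $ j) / of_nat CARD('n)) *\<^sub>C S j)"
    by (simp add: pencil_def cnj_mat_add cnj_mat_sum cnj_mat_mat cnj_mat_cscale cnj_S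
        flip: mat_eq_cscale)
  also have "S i ** g ** (\<dots> ** g') = cnj w *\<^sub>C (S i ** g ** g')
      + (\<Sum>j\<in>UNIV. (cnj (\<gamma> $ j) / of_nat CARD('n)) *\<^sub>C (S i ** g ** S j ** g'))"
    by (simp add: matrix_add_rdistrib matrix_add_ldistrib matrix_mult_sum_left matrix_mult_sum_right
        cscale_mult_left cscale_mult_right matrix_mul_assoc)
  finally have "trace (S i ** g) = trace (cnj w *\<^sub>C (S i ** g ** g')
      + (\<Sum>j\<in>UNIV. (cnj (\<gamma> $ j) / of_nat CARD('n)) *\<^sub>C (S i ** g ** S j ** g')))"
    by (rule arg_cong)
  then show ?thesis
    unfolding g_def[symmetric]
    by (simp add: trace_add trace_sum trace_cscale tr_1 tr_S del: of_real_power)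
qed

lemma Re_denom:
  assumes "(w, \<gamma>) \<in> right_half"
  shows "Re w + (\<Sum>j\<in>UNIV. energy (res w \<gamma>) i j * Re (\<gamma> $ j)) / (real CARD('n))\<^sup>2 \<le> Re (denom S w \<gamma> i)"
proof -
  have "Re (denom S w \<gamma> i) = Re w + Re w * (norm (R i ** res w \<gamma>))\<^sup>2 / real CARD('n)
      + (\<Sum>j\<in>UNIV. energy (res w \<gamma>) i j * Re (\<gamma> $ j)) / (real CARD('n))\<^sup>2"
    by (simp add: denom_def trace_res[OF assms] Re_divide_of_nat sum_divide_distrib add_divide_distrib
        power2_eq_square mult_ac)
  moreover have "0 \<le> Re w * (norm (R i ** res w \<gamma>))\<^sup>2 / real CARD('n)"
    using assms by (auto simp: right_half_def)
  ultimately show ?thesis by linarith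
qed

lemma Re_denom_ge:
  assumes "(w, \<gamma>) \<in> right_half"
  shows "Re w \<le> Re (denom S w \<gamma> i)"
proof -
  have "0 \<le> (\<Sum>j\<in>UNIV. energy (res w \<gamma>) i j * Re (\<gamma> $ j)) / (real CARD('n))\<^sup>2"
    using assms by (auto intro!: divide_nonneg_nonneg sum_nonneg mult_nonneg_nonneg energy_nonneg
        simp: right_half_def)
  with Re_denom[OF assms, of i] show ?thesis by linarith
qed

lemma denom_nonzero:
  assumes "(w, \<gamma>) \<in> right_half"
  shows "denom S w \<gamma> i \<noteq> 0"
  using Re_denom_ge[OF assms, of i] assms by (auto simp: right_half_def)

lemma norm_fixmap_le:
  assumes "(w, \<gamma>) \<in> right_half"
  shows "norm (fixmap S w \<gamma> $ i) \<le> 1 / Re w"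
proof -
  have "Re w \<le> norm (denom S w \<gamma> i)"
    using Re_denom_ge[OF assms, of i] complex_Re_le_cmod order_trans by blast
  then show ?thesis
    using assms by (simp add: fixmap_def norm_divide right_half_def frac_le)
qed

section \<open>Existence in the cone\<close>

text \<open>The conjugates in \<open>trace_res\<close> stay in the cone, hence so does the denominator and its inverse.\<close>

lemma fixmap_cone:
  assumes w: "0 < Re w" and \<gamma>: "\<And>i. \<gamma> $ i \<in> conj_cone w"
  shows "fixmap S w \<gamma> $ i \<in> conj_cone w"
proof -
  have rh: "(w, \<gamma>) \<in> right_half"
    using w \<gamma> cone_Re by (auto simp: right_half_def)
  have n: "x / of_nat CARD('n) = x * of_real (1 / real CARD('n))" for x :: complex
    by simp
  have "denom S w \<gamma> i \<in> conj_cone w"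
    unfolding denom_def trace_res[OF rh] n
    by (intro cone_add cone_scale cone_sum cone_cnj cone_generator \<gamma> energy_nonneg) auto
  then show ?thesis
    by (simp add: fixmap_def cone_inverse)
qed

lemma continuous_on_pencil_nth: "continuous_on X (\<lambda>p. pencil S (fst p) (snd p) $ k $ l)"
  unfolding pencil_def by (cases "k = l") (auto intro!: continuous_intros simp: mat_def)

lemma continuous_on_fixmap: "continuous_on right_half (\<lambda>p. fixmap S (fst p) (snd p))"
  unfolding fixmap_def
proof (intro continuous_on_vec_lambda continuous_on_divide continuous_on_const ballI)
  show "continuous_on right_half (\<lambda>p. denom S (fst p) (snd p) i)" for i
    unfolding denom_def trace_def matrix_matrix_mult_def
    using continuous_on_matrix_inv_nth[OF continuous_on_pencil_nth] invertible_pencil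
    by (auto intro!: continuous_on_add continuous_on_divide continuous_on_sum continuous_on_mult
        continuous_on_const continuous_on_fst continuous_on_id)
qed (auto simp: denom_nonzero)

text \<open>Brouwer's theorem on a truncated cone. Truncating the coefficients \<open>a\<close> and \<open>b\<close> instead of the
  modulus presents the truncation as a linear image of a box, compact and convex also for real \<open>w\<close>,
  when the cone degenerates to a ray.\<close>

lemma solution_exists:
  assumes w: "0 < Re w"
  obtains \<gamma> where "is_solution S w \<gamma>" "\<And>i. \<gamma> $ i \<in> conj_cone w"
proof -
  \<comment> \<open>Values of \<open>fixmap\<close> have \<open>(a + b) Re w\<close> as real part, which is at most \<open>1 / Re w\<close>.\<close>
  define r where "r = 1 / (Re w)\<^sup>2"
  define box where "box = cbox (0 :: real^'n) (\<chi> i. r)"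
  define f :: "(real^'n) \<times> (real^'n) \<Rightarrow> complex^'n"
    where "f p = (\<chi> i. of_real (fst p $ i) * w + of_real (snd p $ i) * cnj w)" for p
  define K where "K = f ` (box \<times> box)"
  have r: "0 \<le> r" by (simp add: r_def)
  have box: "a \<in> box \<longleftrightarrow> (\<forall>i. 0 \<le> a $ i \<and> a $ i \<le> r)" for a
    by (simp add: box_def mem_box_cart)
  have "linear f"
    by (rule linearI) (auto simp: f_def vec_eq_iff algebra_simps scaleR_conv_of_real[where 'a = complex])
  moreover have "convex (box \<times> box)" "compact (box \<times> box)"
    by (auto simp: box_def intro!: convex_Times compact_Times)
  ultimately have "convex K" "compact K"
    unfolding K_def by (auto intro!: convex_linear_image compact_continuous_image linear_continuous_on
        simp: linear_conv_bounded_linear)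
  have K_cone: "\<gamma> $ i \<in> conj_cone w" if "\<gamma> \<in> K" for \<gamma> i
    using that unfolding K_def f_def conj_cone_def by (fastforce simp: box)
  have K_rh: "(w, \<gamma>) \<in> right_half" if "\<gamma> \<in> K" for \<gamma>
    using w cone_Re[OF K_cone[OF that]] by (auto simp: right_half_def)
  have "fixmap S w \<gamma> \<in> K" if \<gamma>: "\<gamma> \<in> K" for \<gamma>
  proof -
    have "\<exists>a b. 0 \<le> a \<and> 0 \<le> b \<and> fixmap S w \<gamma> $ i = of_real a * w + of_real b * cnj w" for i
      using fixmap_cone[OF w K_cone[OF \<gamma>], of i] by (auto simp: conj_cone_def)
    then obtain a b where ab: "\<And>i. 0 \<le> a i" "\<And>i. 0 \<le> b i"
        "\<And>i. fixmap S w \<gamma> $ i = of_real (a i) * w + of_real (b i) * cnj w" by metis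
    have "a i \<le> r \<and> b i \<le> r" for i
    proof -
      have "(a i + b i) * Re w = Re (fixmap S w \<gamma> $ i)"
        by (simp add: ab(3) algebra_simps)
      also have "\<dots> \<le> 1 / Re w"
        using norm_fixmap_le[OF K_rh[OF \<gamma>], of i] complex_Re_le_cmod order_trans by blast
      finally have "a i + b i \<le> r"
        using w by (simp add: r_def field_simps power2_eq_square)
      then show ?thesis using ab(1,2)[of i] by linarith
    qed
    then have "((\<chi> i. a i), (\<chi> i. b i)) \<in> box \<times> box"
      by (auto simp: box ab)
    moreover have "fixmap S w \<gamma> = f ((\<chi> i. a i), (\<chi> i. b i))"
      by (simp add: f_def vec_eq_iff ab)
    ultimately show ?thesis
      unfolding K_def by blast
  qed
  moreover have "continuous_on K (fixmap S w)"
    using continuous_on_compose2[OF continuous_on_fixmap, of K "\<lambda>\<gamma>. (w, \<gamma>)"] K_rh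
    by (auto simp: continuous_on_Pair)
  moreover have "K \<noteq> {}"
    using box[of 0] r by (auto simp: K_def)
  ultimately obtain \<gamma> where "\<gamma> \<in> K" "fixmap S w \<gamma> = \<gamma>"
    using brouwer[of K "fixmap S w"] \<open>compact K\<close> \<open>convex K\<close> by blast
  then show thesis
    using that K_rh K_cone by (auto simp: is_solution_def)
qed

section \<open>Uniqueness\<close>

lemma is_solution_right_half: "is_solution S w \<gamma> \<Longrightarrow> (w, \<gamma>) \<in> right_half"
  by (simp add: is_solution_def)

lemma is_solution_nth: "is_solution S w \<gamma> \<Longrightarrow> \<gamma> $ i = 1 / denom S w \<gamma> i"
  unfolding is_solution_def fixmap_def by (metis vec_lambda_beta)

text \<open>Taking real parts in \<open>\<gamma>\<^sub>i = 1 / d\<^sub>i\<close>, that is \<open>Re \<gamma>\<^sub>i = |\<gamma>\<^sub>i|\<^sup>2 Re d\<^sub>i\<close>, shows that the vector of real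
  parts is positive and strictly shrunk by the nonnegative matrix \<open>|\<gamma>\<^sub>i|\<^sup>2 energy i j / n\<^sup>2\<close>.\<close>

lemma Re_solution:
  assumes sol: "is_solution S w \<gamma>"
  shows "0 < Re (\<gamma> $ i)"
    and "(\<Sum>j\<in>UNIV. (norm (\<gamma> $ i))\<^sup>2 / (real CARD('n))\<^sup>2 * energy (res w \<gamma>) i j * Re (\<gamma> $ j)) < Re (\<gamma> $ i)"
proof -
  note rh = is_solution_right_half[OF sol]
  let ?d = "denom S w \<gamma> i"
  have w: "0 < Re w" using rh by (simp add: right_half_def)
  have d: "?d \<noteq> 0" by (rule denom_nonzero[OF rh])
  have n: "0 < (norm (\<gamma> $ i))\<^sup>2"
    using d by (simp add: is_solution_nth[OF sol, of i])
  have "Re (\<gamma> $ i) = (norm (\<gamma> $ i))\<^sup>2 * Re ?d"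
    unfolding is_solution_nth[OF sol, of i]
    by (simp add: Re_divide norm_divide power_divide cmod_power2)
  moreover have "(norm (\<gamma> $ i))\<^sup>2 * Re ?d \<ge> (norm (\<gamma> $ i))\<^sup>2 * Re w"
    using Re_denom_ge[OF rh, of i] by (intro mult_left_mono) auto
  moreover have "(norm (\<gamma> $ i))\<^sup>2 * Re ?d \<ge> (norm (\<gamma> $ i))\<^sup>2 * Re w
      + (\<Sum>j\<in>UNIV. (norm (\<gamma> $ i))\<^sup>2 / (real CARD('n))\<^sup>2 * energy (res w \<gamma>) i j * Re (\<gamma> $ j))"
    using mult_left_mono[OF Re_denom[OF rh, of i], of "(norm (\<gamma> $ i))\<^sup>2"]
    by (simp add: distrib_left sum_distrib_left sum_divide_distrib mult_ac)
  moreover have "0 < (norm (\<gamma> $ i))\<^sup>2 * Re w"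
    using n w by simp
  ultimately show "0 < Re (\<gamma> $ i)"
    "(\<Sum>j\<in>UNIV. (norm (\<gamma> $ i))\<^sup>2 / (real CARD('n))\<^sup>2 * energy (res w \<gamma>) i j * Re (\<gamma> $ j)) < Re (\<gamma> $ i)"
    by linarith+
qed

text \<open>Cauchy--Schwarz for the Frobenius inner product of \<open>R\<^sub>i g R\<^sub>j\<^sup>T\<close> and \<open>R\<^sub>i g' R\<^sub>j\<^sup>T\<close>. The right-hand side is
  the product of the two matrices that \<open>Re_solution\<close> is about.\<close>

lemma norm_difference_matrix:
  assumes "(w', \<gamma>') \<in> right_half"
  shows "(norm (difference_matrix S w \<gamma> w' \<gamma>' $ i $ j))\<^sup>2
    \<le> ((norm (\<gamma> $ i))\<^sup>2 / (real CARD('n))\<^sup>2 * energy (res w \<gamma>) i j)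
      * ((norm (\<gamma>' $ i))\<^sup>2 / (real CARD('n))\<^sup>2 * energy (res w' \<gamma>') i j)"
proof -
  let ?t = "trace (S i ** res w \<gamma> ** S j ** res w' \<gamma>')"
  let ?c = "(norm (\<gamma> $ i))\<^sup>2 / (real CARD('n))\<^sup>2 * ((norm (\<gamma>' $ i))\<^sup>2 / (real CARD('n))\<^sup>2)"
  have "(norm ?t)\<^sup>2 \<le> energy (res w \<gamma>) i j * energy (res w' \<gamma>') i j"
    unfolding S_eq trace_factorized[OF transpose_res[OF assms]] energy_def
    by (rule norm_trace_mult_transpose_le)
  then have "?c * (norm ?t)\<^sup>2 \<le> ?c * (energy (res w \<gamma>) i j * energy (res w' \<gamma>') i j)"
    by (intro mult_left_mono) auto
  then show ?thesis
    by (simp add: difference_matrix_def norm_mult norm_divide norm_power power_mult_distrib power_divide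
        power2_eq_square mult_ac)
qed

lemma difference_matrix_no_fixed_vector:
  assumes sol: "is_solution S w \<gamma>" "is_solution S w' \<gamma>'"
    and \<Delta>: "\<Delta> = difference_matrix S w \<gamma> w' \<gamma>' *v \<Delta>"
  shows "\<Delta> = 0"
proof -
  have "\<Delta> $ i = 0" for i
  proof (rule geometric_mean_contraction[where A = "\<lambda>i j. difference_matrix S w \<gamma> w' \<gamma>' $ i $ j"
        and v = "\<lambda>i. Re (\<gamma> $ i)" and v' = "\<lambda>i. Re (\<gamma>' $ i)"])
    show "\<Delta> $ i = (\<Sum>j\<in>UNIV. difference_matrix S w \<gamma> w' \<gamma>' $ i $ j * \<Delta> $ j)" for i
      by (subst \<Delta>) (simp add: matrix_vector_mult_def)
  qed (rule norm_difference_matrix[OF is_solution_right_half[OF sol(2)]] Re_solution sol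
      | simp add: energy_nonneg)+
  then show ?thesis by (simp add: vec_eq_iff)
qed

lemma invertible_one_minus_difference_matrix:
  assumes "is_solution S w \<gamma>" "is_solution S w' \<gamma>'"
  shows "invertible (mat 1 - difference_matrix S w \<gamma> w' \<gamma>')"
  unfolding invertible_left_inverse matrix_left_invertible_ker
  using difference_matrix_no_fixed_vector[OF assms]
  by (auto simp: matrix_vector_mult_diff_rdistrib)

text \<open>Subtract the scalar equations, and use \<open>g' - g = g (N - N') g'\<close> for the matrices.\<close>

lemma solution_difference:
  assumes sol: "is_solution S w \<gamma>" "is_solution S w' \<gamma>'"
  shows "(mat 1 - difference_matrix S w \<gamma> w' \<gamma>') *v (\<gamma> - \<gamma>')
    = (w - w') *s (\<chi> i. \<gamma> $ i * \<gamma>' $ i * (trace (S i ** res w \<gamma> ** res w' \<gamma>') / of_nat CARD('n) - 1))"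
proof -
  note rh = sol[THEN is_solution_right_half]
  define g where "g = res w \<gamma>"
  define g' where "g' = res w' \<gamma>'"
  define n :: complex where "n = of_nat CARD('n)"
  have n0: "n \<noteq> 0" by (simp add: n_def)
  have gN: "g ** pencil S w \<gamma> = mat 1" and Ng': "pencil S w' \<gamma>' ** g' = mat 1"
    using rh by (auto simp: g_def g'_def matrix_inv_left matrix_inv_right invertible_pencil)
  have pencil_diff: "pencil S w \<gamma> = pencil S w' \<gamma>' + ((w - w') *\<^sub>C mat 1
      + (\<Sum>j\<in>UNIV. ((\<gamma> $ j - \<gamma>' $ j) / n) *\<^sub>C S j))"
    by (simp add: vec_eq_iff pencil_def n_def mat_def diff_divide_distrib left_diff_distrib sum_subtractf)
  have "g' = g ** pencil S w \<gamma> ** g'"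
    by (simp add: gN)
  also have "\<dots> = g + ((w - w') *\<^sub>C (g ** g')
      + (\<Sum>j\<in>UNIV. ((\<gamma> $ j - \<gamma>' $ j) / n) *\<^sub>C (g ** S j ** g')))"
    unfolding pencil_diff
    by (simp add: matrix_add_ldistrib matrix_add_rdistrib matrix_mult_sum_left matrix_mult_sum_right
        cscale_mult_left cscale_mult_right Ng' flip: matrix_mul_assoc)
  finally have g'_eq: "g' = g + ((w - w') *\<^sub>C (g ** g')
      + (\<Sum>j\<in>UNIV. ((\<gamma> $ j - \<gamma>' $ j) / n) *\<^sub>C (g ** S j ** g')))" .
  have tr: "trace (S i ** g') = trace (S i ** g) + ((w - w') * trace (S i ** g ** g')
      + (\<Sum>j\<in>UNIV. (\<gamma> $ j - \<gamma>' $ j) / n * trace (S i ** g ** S j ** g')))" for i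
    by (subst g'_eq) (simp add: matrix_add_ldistrib matrix_mult_sum_right cscale_mult_right
        trace_add trace_sum trace_cscale matrix_mul_assoc)
  have "\<gamma> $ i - \<gamma>' $ i - (\<Sum>j\<in>UNIV. difference_matrix S w \<gamma> w' \<gamma>' $ i $ j * (\<gamma> $ j - \<gamma>' $ j))
      = (w - w') * (\<gamma> $ i * \<gamma>' $ i * (trace (S i ** g ** g') / n - 1))" for i
  proof -
    have "\<gamma> $ i - \<gamma>' $ i = \<gamma> $ i * \<gamma>' $ i * (denom S w' \<gamma>' i - denom S w \<gamma> i)"
      using denom_nonzero[OF rh(1), of i] denom_nonzero[OF rh(2), of i]
      by (simp add: is_solution_nth[OF sol(1), of i] is_solution_nth[OF sol(2), of i] field_simps)
    also have "denom S w' \<gamma>' i - denom S w \<gamma> i = (w' - w) + (w - w') * (trace (S i ** g ** g') / n)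
        + (\<Sum>j\<in>UNIV. (\<gamma> $ j - \<gamma>' $ j) / n * trace (S i ** g ** S j ** g')) / n"
      unfolding denom_def g_def[symmetric] g'_def[symmetric] n_def[symmetric] tr
      by (simp add: add_divide_distrib)
    also have "\<gamma> $ i * \<gamma>' $ i * \<dots> = (w - w') * (\<gamma> $ i * \<gamma>' $ i * (trace (S i ** g ** g') / n - 1))
        + \<gamma> $ i * \<gamma>' $ i * ((\<Sum>j\<in>UNIV. (\<gamma> $ j - \<gamma>' $ j) / n * trace (S i ** g ** S j ** g')) / n)"
      by (simp add: algebra_simps)
    also have "\<gamma> $ i * \<gamma>' $ i * ((\<Sum>j\<in>UNIV. (\<gamma> $ j - \<gamma>' $ j) / n * trace (S i ** g ** S j ** g')) / n)
        = (\<Sum>j\<in>UNIV. difference_matrix S w \<gamma> w' \<gamma>' $ i $ j * (\<gamma> $ j - \<gamma>' $ j))"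
      unfolding difference_matrix_def g_def[symmetric] g'_def[symmetric] n_def[symmetric]
      by (simp add: sum_distrib_left sum_divide_distrib power2_eq_square mult_ac)
    finally show ?thesis by simp
  qed
  then show ?thesis
    unfolding g_def[symmetric] g'_def[symmetric] n_def[symmetric]
    by (simp add: vec_eq_iff matrix_vector_mult_diff_rdistrib left_diff_distrib)
      (simp add: matrix_vector_mult_def left_diff_distrib)
qed

lemma solution_unique:
  assumes "is_solution S w \<gamma>" "is_solution S w \<gamma>'"
  shows "\<gamma> = \<gamma>'"
proof -
  have "\<gamma> - \<gamma>' = difference_matrix S w \<gamma> w \<gamma>' *v (\<gamma> - \<gamma>')"
    using solution_difference[OF assms] by (simp add: matrix_vector_mult_diff_rdistrib)
  then have "\<gamma> - \<gamma>' = 0"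
    by (rule difference_matrix_no_fixed_vector[OF assms])
  then show ?thesis by simp
qed

section \<open>Holomorphic dependence on the parameter\<close>

definition solution :: "complex \<Rightarrow> complex^'n" where
  "solution w = (THE \<gamma>. is_solution S w \<gamma>)"

lemma solution_eqI: "is_solution S w \<gamma> \<Longrightarrow> solution w = \<gamma>"
  unfolding solution_def using solution_unique by blast

lemma is_solution_solution: "0 < Re w \<Longrightarrow> is_solution S w (solution w)"
  using solution_exists solution_eqI by metis

text \<open>Locally in \<open>w\<close> the solutions stay in a fixed compact set, and their graph is closed because
  uniqueness identifies it with the zero set of a continuous function.\<close>

lemma isCont_solution:
  assumes w: "0 < Re w"
  shows "isCont solution w"
proof -
  define \<delta> where "\<delta> = Re w / 2"
  have \<delta>: "0 < \<delta>" "\<delta> < Re w" using w by (auto simp: \<delta>_def)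
  define X where "X = {w. \<delta> < Re w}"
  define T :: "(complex^'n) set" where "T = {\<gamma>. \<forall>i. 0 \<le> Re (\<gamma> $ i) \<and> norm (\<gamma> $ i) \<le> 1 / \<delta>}"
  have "T \<subseteq> cball 0 (\<Sum>i\<in>(UNIV :: 'n set). 1 / \<delta>)"
  proof
    fix \<gamma> assume "\<gamma> \<in> T"
    then have "(\<Sum>i\<in>UNIV. norm (\<gamma> $ i)) \<le> (\<Sum>i\<in>(UNIV :: 'n set). 1 / \<delta>)"
      by (intro sum_mono) (auto simp: T_def)
    moreover have "norm \<gamma> \<le> (\<Sum>i\<in>UNIV. norm (\<gamma> $ i))"
      unfolding norm_vec_def by (rule L2_set_le_sum) simp
    ultimately show "\<gamma> \<in> cball 0 (\<Sum>i\<in>(UNIV :: 'n set). 1 / \<delta>)"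
      by (simp add: dist_norm)
  qed
  moreover have "closed T"
    unfolding T_def by (intro closed_Collect_all closed_Collect_conj closed_Collect_le continuous_intros)
  ultimately have "compact T"
    using bounded_cball bounded_subset compact_eq_bounded_closed by blast
  have rh: "X \<times> T \<subseteq> right_half"
    using \<delta> by (auto simp: X_def T_def right_half_def)
  have solX: "is_solution S v (solution v)" if "v \<in> X" for v
    using that \<delta> by (intro is_solution_solution) (auto simp: X_def)
  have T: "solution v \<in> T" if "v \<in> X" for v
  proof -
    have sol: "is_solution S v (solution v)" by (rule solX[OF that])
    have "norm (solution v $ i) \<le> 1 / \<delta>" for i
    proof -
      have "norm (solution v $ i) \<le> 1 / Re v"
        using norm_fixmap_le[OF is_solution_right_half[OF sol], of i] sol
        by (simp add: is_solution_def)
      also have "\<dots> \<le> 1 / \<delta>"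
        using \<delta> that by (intro divide_left_mono) (auto simp: X_def)
      finally show ?thesis .
    qed
    then show ?thesis
      using is_solution_right_half[OF sol] by (auto simp: T_def right_half_def)
  qed
  have "(\<lambda>v. (v, solution v)) ` X
      = {p \<in> X \<times> T. snd p - fixmap S (fst p) (snd p) = 0}"
  proof (intro equalityI subsetI)
    fix p assume "p \<in> (\<lambda>v. (v, solution v)) ` X"
    then show "p \<in> {p \<in> X \<times> T. snd p - fixmap S (fst p) (snd p) = 0}"
      using T solX by (auto simp: is_solution_def)
  next
    fix p assume p: "p \<in> {p \<in> X \<times> T. snd p - fixmap S (fst p) (snd p) = 0}"
    then have "is_solution S (fst p) (snd p)"
      using rh by (auto simp: is_solution_def)
    then show "p \<in> (\<lambda>v. (v, solution v)) ` X"
      using solution_eqI p by (intro image_eqI[of _ _ "fst p"]) (auto simp: prod_eq_iff)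
  qed
  also have "closedin (top_of_set (X \<times> T)) \<dots>"
    by (intro continuous_closedin_preimage_constant continuous_intros
        continuous_on_subset[OF continuous_on_fixmap rh])
  finally have "continuous_on X solution"
    using continuous_closed_graph_eq[OF \<open>compact T\<close>, of solution X] T by auto
  moreover have "open X" "w \<in> X"
    using \<delta> by (auto simp: X_def open_halfspace_Re_gt)
  ultimately show ?thesis
    using continuous_on_eq_continuous_at by blast
qed

text \<open>The divided difference at \<open>w\<close> solves a linear system whose coefficients converge and whose
  matrix stays invertible in the limit, so Cramer's rule yields its limit.\<close>

lemma solution_field_differentiable:
  assumes w: "0 < Re w"
  shows "(\<lambda>v. solution v $ i) field_differentiable at w"
proof -
  define C where "C v = mat 1 - difference_matrix S v (solution v) w (solution w)" for v
  define b :: "complex \<Rightarrow> complex^'n" where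
    "b v = (\<chi> i. solution v $ i * solution w $ i
       * (trace (S i ** res v (solution v) ** res w (solution w)) / of_nat CARD('n) - 1))" for v
  define D where "D v = det (\<chi> k l. if l = i then b v $ k else C v $ k $ l) / det (C v)" for v
  have ev: "\<forall>\<^sub>F v in at w. 0 < Re v"
    using w open_halfspace_Re_gt[of 0] by (auto simp: eventually_at_topological)
  have sol: "((\<lambda>v. solution v $ k) \<longlongrightarrow> solution w $ k) (at w)" for k
    using isCont_solution[OF w] unfolding isCont_def by (rule tendsto_vec_nth)
  have res: "((\<lambda>v. res v (solution v) $ k $ l) \<longlongrightarrow> res w (solution w) $ k $ l) (at w)" for k l
  proof -
    have "continuous_on {v. 0 < Re v} (\<lambda>v. res v (solution v) $ k $ l)"
    proof (rule continuous_on_matrix_inv_nth)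
      show "continuous_on {v. 0 < Re v} (\<lambda>v. pencil S v (solution v) $ i $ j)" for i j
        using continuous_on_compose2[OF continuous_on_pencil_nth[of UNIV] _ subset_UNIV,
            of "{v. 0 < Re v}" "\<lambda>v. (v, solution v)"]
        by (simp add: continuous_on_Pair continuous_at_imp_continuous_on isCont_solution)
    qed (auto intro: invertible_pencil is_solution_right_half is_solution_solution)
    then show ?thesis
      using w open_halfspace_Re_gt[of 0] by (auto simp: continuous_on_eq_continuous_at isCont_def)
  qed
  have b: "((\<lambda>v. b v $ k) \<longlongrightarrow> b w $ k) (at w)" for k
    unfolding b_def trace_def matrix_matrix_mult_def by (auto intro!: tendsto_intros sol res)
  have C: "((\<lambda>v. C v $ k $ l) \<longlongrightarrow> C w $ k $ l) (at w)" for k l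
    unfolding C_def difference_matrix_def trace_def matrix_matrix_mult_def
    by (auto intro!: tendsto_intros sol res)
  have C_inv: "det (C v) \<noteq> 0" if "0 < Re v" for v
    using invertible_one_minus_difference_matrix[OF is_solution_solution[OF that] is_solution_solution[OF w]]
    by (simp add: C_def invertible_det_nz)
  have "(D \<longlongrightarrow> D w) (at w)"
    unfolding D_def
  proof (intro tendsto_divide tendsto_det C C_inv[OF w])
    show "((\<lambda>v. (\<chi> k l. if l = i then b v $ k else C v $ k $ l) $ k $ l) \<longlongrightarrow>
        (\<chi> k l. if l = i then b w $ k else C w $ k $ l) $ k $ l) (at w)" for k l
      using b C by (cases "l = i") auto
  qed
  moreover have "\<forall>\<^sub>F v in at w. D v = (solution v $ i - solution w $ i) / (v - w)"
    using ev eventually_neq_at_within[of w w UNIV]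
  proof eventually_elim
    case (elim v)
    define q where "q = (1 / (v - w)) *s (solution v - solution w)"
    have "C v *v q = (1 / (v - w)) *s (C v *v (solution v - solution w))"
      unfolding q_def by (rule vector_scalar_commute)
    also have "C v *v (solution v - solution w) = (v - w) *s b v"
      unfolding C_def b_def
      by (rule solution_difference[OF is_solution_solution is_solution_solution]) (use elim w in auto)
    also have "(1 / (v - w)) *s \<dots> = b v"
      unfolding vector_smult_assoc using elim by simp
    finally have "q $ i = D v"
      unfolding D_def using cramer[OF C_inv[OF elim(1)]] by simp
    then show ?case
      by (simp add: q_def diff_divide_distrib)
  qed
  ultimately have "((\<lambda>v. (solution v $ i - solution w $ i) / (v - w)) \<longlongrightarrow> D w) (at w)"
    by (rule Lim_transform_eventually)
  then show ?thesis
    unfolding field_differentiable_def has_field_derivative_iff by blast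
qed

lemma holomorphic_on_solution: "(\<lambda>w. solution w $ i) holomorphic_on {w. 0 < Re w}"
  unfolding holomorphic_on_def
  using solution_field_differentiable field_differentiable_at_within by blast

end

section \<open>The substitution \<open>z = - w\<^sup>2\<close>\<close>

lemma Omega_csqrt:
  assumes "z \<in> Omega"
  shows "0 < Re (csqrt (- z))" and "- z \<notin> \<real>\<^sub>\<le>\<^sub>0" and "z = - (csqrt (- z))\<^sup>2"
proof -
  have "z \<notin> \<real>\<^sub>\<ge>\<^sub>0"
    using assms by (auto simp: Omega_def nonneg_Reals_def)
  then show "- z \<notin> \<real>\<^sub>\<le>\<^sub>0" by simp
  show "0 < Re (csqrt (- z))"
  proof (rule ccontr)
    assume "\<not> 0 < Re (csqrt (- z))"
    then have "csqrt (- z) = \<i> * of_real (Im (csqrt (- z)))"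
      using csqrt_principal[of "- z"] by (simp add: complex_eq_iff)
    then have "- z = (\<i> * of_real (Im (csqrt (- z))))\<^sup>2"
      by (metis power2_csqrt)
    then have "z = of_real ((Im (csqrt (- z)))\<^sup>2)"
      by (simp add: power_mult_distrib)
    then have "z \<in> \<real>\<^sub>\<ge>\<^sub>0"
      by (metis nonneg_Reals_of_real_iff zero_le_power2)
    with \<open>z \<notin> \<real>\<^sub>\<ge>\<^sub>0\<close> show False by blast
  qed
qed (simp add: power2_csqrt)

lemma gamma_cone_iff:
  assumes w: "0 < Re w"
  shows "G \<in> gamma_cone (- w\<^sup>2) \<longleftrightarrow> w * G \<in> conj_cone w"
proof -
  have w0: "w \<noteq> 0" using w by auto
  define m where "m = (norm w)\<^sup>2"
  have m: "0 < m" "of_real m = w * cnj w"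
    using w0 by (auto simp: m_def complex_norm_square simp del: of_real_power)
  have cw: "cnj w = of_real m / w" using w0 by (simp add: m)
  have "G \<in> gamma_cone (- w\<^sup>2) \<longleftrightarrow>
      (\<exists>a b. 0 \<le> a \<and> 0 \<le> b \<and> w * G = of_real a * w + of_real (b / m) * cnj w)"
  proof -
    have "G = of_real a - of_real b / (- w\<^sup>2) \<longleftrightarrow> w * G = of_real a * w + of_real (b / m) * cnj w" for a b
      using w0 m(1) by (simp add: cw field_simps power2_eq_square)
    then show ?thesis unfolding gamma_cone_def by auto
  qed
  also have "\<dots> \<longleftrightarrow> w * G \<in> conj_cone w"
  proof
    assume "\<exists>a b. 0 \<le> a \<and> 0 \<le> b \<and> w * G = of_real a * w + of_real (b / m) * cnj w"
    then show "w * G \<in> conj_cone w"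
      using m(1) unfolding conj_cone_def by (auto simp del: of_real_divide intro: divide_nonneg_pos)
  next
    assume "w * G \<in> conj_cone w"
    then obtain a b where "0 \<le> a" "0 \<le> b" "w * G = of_real a * w + of_real b * cnj w"
      by (auto simp: conj_cone_def)
    then show "\<exists>a b. 0 \<le> a \<and> 0 \<le> b \<and> w * G = of_real a * w + of_real (b / m) * cnj w"
      using m(1) by (intro exI[of _ a] exI[of _ "b * m"]) auto
  qed
  finally show ?thesis .
qed

context gram_family
begin

text \<open>Dictionary between the two systems. The unknown \<open>\<gamma>\<close> is \<open>w \<Gamma>\<close>, and the matrix inverted by the
  original system is \<open>1 / w\<close> times the pencil.\<close>

lemma resolvent_system_iff:
  fixes \<Sigma> :: "'n \<Rightarrow> real^'p^'p"
  assumes w: "0 < Re w" and \<Sigma>: "\<And>j. S j = complex_mat (\<Sigma> j)"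
  shows "(\<forall>i. \<Gamma> i \<in> gamma_cone (- w\<^sup>2)) \<and> resolvent_system \<Sigma> (- w\<^sup>2) \<Gamma> G \<longleftrightarrow>
    (\<forall>i. \<Gamma> i = solution w $ i / w) \<and> G = (1 / w) *\<^sub>C res w (solution w)"
proof -
  have w0: "w \<noteq> 0" using w by auto
  define \<gamma> where "\<gamma> = (\<chi> i. w * \<Gamma> i)"
  have \<Gamma>: "\<Gamma> i = \<gamma> $ i / w" for i
    using w0 by (simp add: \<gamma>_def)
  define M where "M = mat 1 + (1 / real CARD('n)) *\<^sub>R (\<Sum>j\<in>UNIV. \<Gamma> j *\<^sub>C complex_mat (\<Sigma> j))"
  have M: "M = (1 / w) *\<^sub>C pencil S w \<gamma>"
    using w0 by (simp add: vec_eq_iff M_def pencil_def \<Gamma> \<Sigma> mat_def scaleR_conv_of_real[where 'a = complex]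
        sum_distrib_left field_simps)
  have M_inv: "invertible M" "matrix_inv M = w *\<^sub>C res w \<gamma>" if "(w, \<gamma>) \<in> right_half"
  proof -
    have "M ** (w *\<^sub>C res w \<gamma>) = mat 1"
      using w0 by (simp add: M cscale_mult_left cscale_mult_right cscale_cscale
          matrix_inv_right[OF invertible_pencil[OF that]])
        (simp add: vec_eq_iff)
    then show "invertible M" "matrix_inv M = w *\<^sub>C res w \<gamma>"
      using invertible_right_inverse matrix_inv_unique by auto
  qed
  have cone: "\<Gamma> i \<in> gamma_cone (- w\<^sup>2) \<longleftrightarrow> \<gamma> $ i \<in> conj_cone w" for i
    by (simp add: gamma_cone_iff[OF w] \<gamma>_def)
  have rh: "(w, \<gamma>) \<in> right_half" if "\<And>i. \<gamma> $ i \<in> conj_cone w"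
    using that w cone_Re by (auto simp: right_half_def)
  have G: "(- 1 / (- w\<^sup>2)) *\<^sub>C w *\<^sub>C res w \<gamma> = (1 / w) *\<^sub>C res w \<gamma>"
    using w0 by (simp add: cscale_cscale power2_eq_square)
  have d: "- w\<^sup>2 * (1 + 1 / of_nat CARD('n) * trace (complex_mat (\<Sigma> i) ** ((1 / w) *\<^sub>C res w \<gamma>)))
      = - w * denom S w \<gamma> i" for i
    using w0 by (simp add: denom_def \<Sigma> cscale_mult_right trace_cscale field_simps power2_eq_square)
  have sys: "resolvent_system \<Sigma> (- w\<^sup>2) \<Gamma> G \<longleftrightarrow>
      G = (1 / w) *\<^sub>C res w \<gamma> \<and> is_solution S w \<gamma>" if rh: "(w, \<gamma>) \<in> right_half"
  proof -
    have "resolvent_system \<Sigma> (- w\<^sup>2) \<Gamma> G \<longleftrightarrow> G = (1 / w) *\<^sub>C res w \<gamma> \<and>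
        (\<forall>i. - w * denom S w \<gamma> i \<noteq> 0 \<and> \<Gamma> i = - 1 / (- w * denom S w \<gamma> i))"
      unfolding resolvent_system_def M_def[symmetric] Let_def M_inv(2)[OF rh] G
      using M_inv(1)[OF rh] by (auto simp only: d)
    also have "(\<forall>i. - w * denom S w \<gamma> i \<noteq> 0 \<and> \<Gamma> i = - 1 / (- w * denom S w \<gamma> i))
        \<longleftrightarrow> fixmap S w \<gamma> = \<gamma>"
      using w0 denom_nonzero[OF rh] by (auto simp: vec_eq_iff fixmap_def \<Gamma> field_simps)
    finally show ?thesis
      using rh by (simp add: is_solution_def)
  qed
  have sol_cone: "solution w $ i \<in> conj_cone w" for i
    using solution_exists[OF w] solution_eqI by metis
  have \<gamma>_sol: "(\<forall>i. \<Gamma> i = solution w $ i / w) \<longleftrightarrow> \<gamma> = solution w"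
    using w0 by (auto simp: vec_eq_iff \<gamma>_def field_simps)
  show ?thesis
  proof
    assume L: "(\<forall>i. \<Gamma> i \<in> gamma_cone (- w\<^sup>2)) \<and> resolvent_system \<Sigma> (- w\<^sup>2) \<Gamma> G"
    then have "(w, \<gamma>) \<in> right_half" by (intro rh) (auto simp: cone)
    with L have G': "G = (1 / w) *\<^sub>C res w \<gamma>" and "is_solution S w \<gamma>"
      using sys by auto
    then have "solution w = \<gamma>" by (intro solution_eqI)
    with G' show "(\<forall>i. \<Gamma> i = solution w $ i / w) \<and> G = (1 / w) *\<^sub>C res w (solution w)"
      using \<gamma>_sol by auto
  next
    assume "(\<forall>i. \<Gamma> i = solution w $ i / w) \<and> G = (1 / w) *\<^sub>C res w (solution w)"
    then have \<gamma>: "\<gamma> = solution w" and G': "G = (1 / w) *\<^sub>C res w \<gamma>"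
      using \<gamma>_sol by auto
    have "is_solution S w \<gamma>"
      unfolding \<gamma> by (rule is_solution_solution[OF w])
    then show "(\<forall>i. \<Gamma> i \<in> gamma_cone (- w\<^sup>2)) \<and> resolvent_system \<Sigma> (- w\<^sup>2) \<Gamma> G"
      using sys[OF is_solution_right_half] G' sol_cone by (simp add: cone \<gamma>)
  qed
qed

end

theorem theorem1p1:
  fixes \<Sigma> :: "'n::finite \<Rightarrow> real^'p^'p"
  assumes "\<And>j. pos_semidef (\<Sigma> j)"
  shows "(\<forall>z\<in>Omega. \<exists>!s. (\<forall>i. fst s i \<in> gamma_cone z) \<and> resolvent_system \<Sigma> z (fst s) (snd s)) \<and>
         (\<forall>\<Gamma> G. (\<forall>z\<in>Omega. (\<forall>i. \<Gamma> z i \<in> gamma_cone z) \<and> resolvent_system \<Sigma> z (\<Gamma> z) (G z)) \<longrightarrow>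
           (\<forall>i. (\<lambda>z. \<Gamma> z i) holomorphic_on Omega) \<and>
           (\<forall>k l. (\<lambda>z. G z $ k $ l) holomorphic_on Omega))"
proof -
  have "\<exists>R :: real^'p^'p. \<Sigma> j = transpose R ** R" for j
  proof -
    obtain R :: "real^'p^'p" where "\<Sigma> j = transpose R ** R"
      by (rule pos_semidef_factorization[OF assms[of j]])
    then show ?thesis by blast
  qed
  then obtain R :: "'n \<Rightarrow> real^'p^'p" where R: "\<And>j. \<Sigma> j = transpose (R j) ** R j" by metis
  interpret gram_family "\<lambda>j. complex_mat (R j)" "\<lambda>j. complex_mat (\<Sigma> j)"
    by unfold_locales (simp_all add: R vec_eq_iff matrix_matrix_mult_def transpose_def)
  define w where "w z = csqrt (- z)" for z
  have w: "0 < Re (w z)" if "z \<in> Omega" for z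
    using Omega_csqrt(1)[OF that] by (simp add: w_def)
  have iff: "(\<forall>i. \<Gamma> i \<in> gamma_cone z) \<and> resolvent_system \<Sigma> z \<Gamma> G \<longleftrightarrow>
      (\<forall>i. \<Gamma> i = solution (w z) $ i / w z) \<and> G = (1 / w z) *\<^sub>C res (w z) (solution (w z))"
    if "z \<in> Omega" for z \<Gamma> G
    using resolvent_system_iff[OF w[OF that] refl, of \<Gamma> G] Omega_csqrt(3)[OF that]
    by (simp add: w_def)
  have hw: "w holomorphic_on Omega"
    unfolding w_def by (intro holomorphic_intros) (use Omega_csqrt(2) in auto)
  have hsol: "(\<lambda>z. solution (w z) $ i) holomorphic_on Omega" for i
    using holomorphic_on_compose_gen[OF hw holomorphic_on_solution, of i] w by (auto simp: o_def)
  have hres: "(\<lambda>z. res (w z) (solution (w z)) $ k $ l) holomorphic_on Omega" for k l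
  proof (rule holomorphic_on_matrix_inv_nth)
    show "(\<lambda>z. pencil (\<lambda>j. complex_mat (\<Sigma> j)) (w z) (solution (w z)) $ k $ l) holomorphic_on Omega" for k l
      unfolding pencil_def by (cases "k = l") (auto intro!: holomorphic_intros hsol hw simp: mat_def)
  qed (use w in \<open>auto intro: invertible_pencil is_solution_right_half is_solution_solution\<close>)
  have w0: "w z \<noteq> 0" if "z \<in> Omega" for z
    using w[OF that] by auto
  show ?thesis
  proof (intro conjI ballI allI impI)
    fix z assume z: "z \<in> Omega"
    show "\<exists>!s. (\<forall>i. fst s i \<in> gamma_cone z) \<and> resolvent_system \<Sigma> z (fst s) (snd s)"
      unfolding iff[OF z]
      by (rule ex1I[of _ "(\<lambda>i. solution (w z) $ i / w z, (1 / w z) *\<^sub>C res (w z) (solution (w z)))"])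
        (auto simp: prod_eq_iff)
  next
    fix \<Gamma> G i
    assume "\<forall>z\<in>Omega. (\<forall>i. \<Gamma> z i \<in> gamma_cone z) \<and> resolvent_system \<Sigma> z (\<Gamma> z) (G z)"
    then have "\<Gamma> z i = solution (w z) $ i / w z" if "z \<in> Omega" for z
      using iff[OF that] that by blast
    moreover have "(\<lambda>z. solution (w z) $ i / w z) holomorphic_on Omega"
      by (intro holomorphic_intros hsol hw w0)
    ultimately show "(\<lambda>z. \<Gamma> z i) holomorphic_on Omega"
      by (simp cong: holomorphic_cong)
  next
    fix \<Gamma> G k l
    assume "\<forall>z\<in>Omega. (\<forall>i. \<Gamma> z i \<in> gamma_cone z) \<and> resolvent_system \<Sigma> z (\<Gamma> z) (G z)"
    then have "G z = (1 / w z) *\<^sub>C res (w z) (solution (w z))" if "z \<in> Omega" for z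
      using iff[OF that] that by blast
    then have "G z $ k $ l = 1 / w z * res (w z) (solution (w z)) $ k $ l" if "z \<in> Omega" for z
      using that by simp
    moreover have "(\<lambda>z. 1 / w z * res (w z) (solution (w z)) $ k $ l) holomorphic_on Omega"
      by (intro holomorphic_intros hres hw w0)
    ultimately show "(\<lambda>z. G z $ k $ l) holomorphic_on Omega"
      by (simp cong: holomorphic_cong)
  qed
qed

end
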